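(* Let $X$ and $Y$ be compact Hausdorff spaces equipped with regular Borel probability measures $\mu$ and $\nu$ respectively. Let $\varphi\colon X\to Y$ be an onto Borel map such that $\varphi$ and $\varphi^{-1}$ preserve the null sets. Suppose that there is a family $\{\psi_1,\dots,\psi_N\}$ of $N$ Borel sections of $\varphi$ such that $\psi_i(Y)\cap\psi_j(Y)=\emptyset$ for $i\neq j$, and $\bigcup_{i=1}^N\psi_i(Y)$ is almost equal to $X$ (its complement is $\mu$-null). Then there is a Cuntz family $\{S_i\}_{i=1}^N$ that implements $\alpha\colon L^\infty(Y,\nu)\to L^\infty(X,\mu)$, $\alpha(f)=f\circ\varphi$.
   Context: "$\varphi$ preserves the null sets" means $\nu\circ\varphi\ll\mu$: if $E\subseteq X$ is $\mu$-null then $\varphi(E)$ is $\nu$-null. "$\varphi^{-1}$ preserves the null sets" means $\mu\circ\varphi^{-1}\ll\nu$: if $F\subseteq Y$ is $\nu$-null then $\varphi^{-1}(F)$ is $\mu$-null (this makes $\alpha$ well defined). For an onto Borel map $\varphi\colon X\to Y$, a Borel section of $\varphi$ is a Borel map $\psi\colon Y\to X$ with $\varphi\circ\psi=\mathrm{id}_Y$. $M_g$ denotes multiplication by $g$. A Cuntz family $\{S_i\}_{i=1}^N$ implementing $\alpha$ consists of bounded operators $S_i\colon L^2(Y,\nu)\to L^2(X,\mu)$ with $S_i^*S_j=\delta_{ij}I$, $\sum_{i=1}^N S_iS_i^*=I$, and $M_{\alpha(f)}=\sum_{i=1}^N S_iM_fS_i^*$ for all $f\in L^\infty(Y,\nu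)$.
   Formalization: Each image ψ_i(Y) is additionally assumed measurable for the completion of μ; without this the claim fails, e.g. for the split interval over [0,1] with its two sections t ↦ t^±. It is automatic when X is metrizable. *)

theory Defs
  imports "HOL-Probability.Probability"
begin

section \<open>Regular Borel measures, null sets, Borel sections\<close>

definition regular_borel_measure :: "'a::topological_space measure \<Rightarrow> bool" where
  "regular_borel_measure M \<longleftrightarrow>
     sets M = sets borel \<and>
     (\<forall>A\<in>sets M. emeasure M A = (INF U\<in>{U. open U \<and> A \<subseteq> U}. emeasure M U)) \<and>
     (\<forall>A\<in>sets M. emeasure M A = (SUP K\<in>{K. compact K \<and> K \<subseteq> A}. emeasure M K))"

text \<open>A null set is a set contained in a Borel set of measure zero, that is, a null set of
  the completion. (The image of a Borel null set need not be Borel.)\<close>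

definition preserves_null_sets :: "'a measure \<Rightarrow> 'b measure \<Rightarrow> ('a \<Rightarrow> 'b) \<Rightarrow> bool" where
  "preserves_null_sets M N \<phi> \<longleftrightarrow>
     (\<forall>E\<in>null_sets (completion M). \<phi> ` E \<in> null_sets (completion N))"

definition inverse_preserves_null_sets :: "'a measure \<Rightarrow> 'b measure \<Rightarrow> ('a \<Rightarrow> 'b) \<Rightarrow> bool" where
  "inverse_preserves_null_sets M N \<phi> \<longleftrightarrow>
     (\<forall>F\<in>null_sets (completion N). \<phi> -` F \<inter> space M \<in> null_sets (completion M))"

text \<open>The range of a Borel section is Borel if the domain of \<open>\<phi>\<close> is second countable, but for a
  general compact Hausdorff domain it need not be measurable for the completion: the two
  sections of the split interval over \<open>[0,1]\<close> have non-measurable ranges. Measurability of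
  the ranges therefore has to be assumed where it is used.\<close>

definition borel_section ::
    "('a::topological_space \<Rightarrow> 'b::topological_space) \<Rightarrow> ('b \<Rightarrow> 'a) \<Rightarrow> bool" where
  "borel_section \<phi> \<psi> \<longleftrightarrow> \<psi> \<in> borel \<rightarrow>\<^sub>M borel \<and> \<phi> \<circ> \<psi> = id"


section \<open>The spaces of square integrable and of essentially bounded functions\<close>

text \<open>Elements of these spaces are equivalence classes of complex-valued measurable functions
  modulo equality almost everywhere. Operations on classes are defined through
  representatives; the lemmas below show that the choice does not matter.\<close>

definition ae_class :: "'a measure \<Rightarrow> ('a \<Rightarrow> complex) \<Rightarrow> ('a \<Rightarrow> complex) set" where
  "ae_class M f = {g \<in> borel_measurable M. AE x in M. g x = f x}"

definition rep :: "('a \<Rightarrow> complex) set \<Rightarrow> 'a \<Rightarrow> complex" where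
  "rep u = (SOME f. f \<in> u)"

definition L2 :: "'a measure \<Rightarrow> ('a \<Rightarrow> complex) set set" where
  "L2 M = ae_class M ` {f \<in> borel_measurable M. integrable M (\<lambda>x. (cmod (f x))\<^sup>2)}"

definition Linf :: "'a measure \<Rightarrow> ('a \<Rightarrow> complex) set set" where
  "Linf M = ae_class M ` {f \<in> borel_measurable M. \<exists>C::real. AE x in M. cmod (f x) \<le> C}"

definition l2_zero :: "'a measure \<Rightarrow> ('a \<Rightarrow> complex) set" where
  "l2_zero M = ae_class M (\<lambda>_. 0)"

definition l2_add ::
    "'a measure \<Rightarrow> ('a \<Rightarrow> complex) set \<Rightarrow> ('a \<Rightarrow> complex) set \<Rightarrow> ('a \<Rightarrow> complex) set" where
  "l2_add M u v = ae_class M (\<lambda>x. rep u x + rep v x)"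

definition l2_scale ::
    "'a measure \<Rightarrow> complex \<Rightarrow> ('a \<Rightarrow> complex) set \<Rightarrow> ('a \<Rightarrow> complex) set" where
  "l2_scale M c u = ae_class M (\<lambda>x. c * rep u x)"

definition l2_sum ::
    "'a measure \<Rightarrow> 'i set \<Rightarrow> ('i \<Rightarrow> ('a \<Rightarrow> complex) set) \<Rightarrow> ('a \<Rightarrow> complex) set" where
  "l2_sum M I F = ae_class M (\<lambda>x. \<Sum>i\<in>I. rep (F i) x)"

text \<open>Linear in the first argument, conjugate linear in the second.\<close>

definition l2_inner ::
    "'a measure \<Rightarrow> ('a \<Rightarrow> complex) set \<Rightarrow> ('a \<Rightarrow> complex) set \<Rightarrow> complex" where
  "l2_inner M u v = (LINT x|M. rep u x * cnj (rep v x))"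

definition l2_norm :: "'a measure \<Rightarrow> ('a \<Rightarrow> complex) set \<Rightarrow> real" where
  "l2_norm M u = sqrt (LINT x|M. (cmod (rep u x))\<^sup>2)"

text \<open>For \<open>f\<close> in \<^term>\<open>Linf M\<close>, the multiplication operator by \<open>f\<close> on \<^term>\<open>L2 M\<close>.\<close>

definition mult_op ::
    "'a measure \<Rightarrow> ('a \<Rightarrow> complex) set \<Rightarrow> ('a \<Rightarrow> complex) set \<Rightarrow> ('a \<Rightarrow> complex) set" where
  "mult_op M f u = ae_class M (\<lambda>x. rep f x * rep u x)"

definition pullback ::
    "'a measure \<Rightarrow> ('a \<Rightarrow> 'b) \<Rightarrow> ('b \<Rightarrow> complex) set \<Rightarrow> ('a \<Rightarrow> complex) set" where
  "pullback M \<phi> f = ae_class M (rep f \<circ> \<phi>)"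

lemma ae_class_cong:
  assumes "AE x in M. f x = g x"
  shows "ae_class M f = ae_class M g"
  using assms unfolding ae_class_def by (auto elim: AE_mp)

lemma ae_class_eq_iff:
  assumes "f \<in> borel_measurable M"
  shows "ae_class M f = ae_class M g \<longleftrightarrow> (AE x in M. f x = g x)"
proof
  assume "ae_class M f = ae_class M g"
  moreover have "f \<in> ae_class M f"
    using assms by (simp add: ae_class_def)
  ultimately show "AE x in M. f x = g x"
    by (simp add: ae_class_def)
qed (rule ae_class_cong)

lemma rep_ae_class:
  assumes "f \<in> borel_measurable M"
  shows "rep (ae_class M f) \<in> borel_measurable M" "AE x in M. rep (ae_class M f) x = f x"
proof -
  have "f \<in> ae_class M f"
    using assms by (simp add: ae_class_def)
  then have "rep (ae_class M f) \<in> ae_class M f"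
    unfolding rep_def by (rule someI[where P = "\<lambda>g. g \<in> ae_class M f"])
  then show "rep (ae_class M f) \<in> borel_measurable M" "AE x in M. rep (ae_class M f) x = f x"
    by (auto simp: ae_class_def)
qed

lemma l2_add_ae_class:
  assumes "f \<in> borel_measurable M" "g \<in> borel_measurable M"
  shows "l2_add M (ae_class M f) (ae_class M g) = ae_class M (\<lambda>x. f x + g x)"
  unfolding l2_add_def
  using rep_ae_class(2)[OF assms(1)] rep_ae_class(2)[OF assms(2)]
  by (intro ae_class_cong) auto

lemma l2_scale_ae_class:
  assumes "f \<in> borel_measurable M"
  shows "l2_scale M c (ae_class M f) = ae_class M (\<lambda>x. c * f x)"
  unfolding l2_scale_def
  using rep_ae_class(2)[OF assms] by (intro ae_class_cong) auto

lemma l2_sum_ae_class: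
  assumes "finite I" "\<And>i. i \<in> I \<Longrightarrow> f i \<in> borel_measurable M"
  shows "l2_sum M I (\<lambda>i. ae_class M (f i)) = ae_class M (\<lambda>x. \<Sum>i\<in>I. f i x)"
proof -
  have "AE x in M. \<forall>i\<in>I. rep (ae_class M (f i)) x = f i x"
    using assms by (intro AE_finite_allI rep_ae_class(2))
  then show ?thesis
    unfolding l2_sum_def by (intro ae_class_cong) auto
qed

lemma mult_op_ae_class:
  assumes "f \<in> borel_measurable M" "g \<in> borel_measurable M"
  shows "mult_op M (ae_class M f) (ae_class M g) = ae_class M (\<lambda>x. f x * g x)"
  unfolding mult_op_def
  using rep_ae_class(2)[OF assms(1)] rep_ae_class(2)[OF assms(2)]
  by (intro ae_class_cong) auto

lemma l2_inner_ae_class: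
  assumes [measurable]: "f \<in> borel_measurable M" "g \<in> borel_measurable M"
  shows "l2_inner M (ae_class M f) (ae_class M g) = (LINT x|M. f x * cnj (g x))"
proof -
  note [measurable] = rep_ae_class(1)[OF assms(1)] rep_ae_class(1)[OF assms(2)]
  have [measurable]: "cnj \<in> borel_measurable borel"
    by (intro borel_measurable_continuous_onI continuous_intros)
  show ?thesis
    unfolding l2_inner_def
    using rep_ae_class(2)[OF assms(1)] rep_ae_class(2)[OF assms(2)]
    by (intro integral_cong_AE) auto
qed

lemma l2_norm_ae_class:
  assumes [measurable]: "f \<in> borel_measurable M"
  shows "l2_norm M (ae_class M f) = sqrt (LINT x|M. (cmod (f x))\<^sup>2)"
proof -
  note [measurable] = rep_ae_class(1)[OF assms(1)]
  show ?thesis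
    unfolding l2_norm_def
    using rep_ae_class(2)[OF assms(1)]
    by (intro arg_cong[where f = sqrt] integral_cong_AE) auto
qed

lemma AE_pullback:
  assumes "\<phi> \<in> M \<rightarrow>\<^sub>M N" "inverse_preserves_null_sets M N \<phi>" "AE y in N. P y"
  shows "AE x in M. P (\<phi> x)"
proof -
  obtain F where F: "{y \<in> space N. \<not> P y} \<subseteq> F" "F \<in> null_sets N"
    using assms(3) unfolding eventually_ae_filter by blast
  then have "\<phi> -` F \<inter> space M \<in> null_sets (completion M)"
    using assms(2) by (auto simp: inverse_preserves_null_sets_def intro: null_sets_completionI)
  moreover have "{x \<in> space M. \<not> P (\<phi> x)} \<subseteq> \<phi> -` F \<inter> space M"
    using F(1) measurable_space[OF assms(1)] by auto
  ultimately have "AE x in completion M. P (\<phi> x)"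
    by (intro AE_I'[of "\<phi> -` F \<inter> space M"]) auto
  then show ?thesis
    by (simp add: AE_completion_iff)
qed

lemma pullback_ae_class:
  assumes "\<phi> \<in> M \<rightarrow>\<^sub>M N" "inverse_preserves_null_sets M N \<phi>" "f \<in> borel_measurable N"
  shows "pullback M \<phi> (ae_class N f) = ae_class M (f \<circ> \<phi>)"
  unfolding pullback_def
  using AE_pullback[OF assms(1,2) rep_ae_class(2)[OF assms(3)]]
  by (intro ae_class_cong) auto

lemma pullback_Linf:
  assumes "\<phi> \<in> M \<rightarrow>\<^sub>M N" "inverse_preserves_null_sets M N \<phi>" "u \<in> Linf N"
  shows "pullback M \<phi> u \<in> Linf M"
proof -
  obtain f C where f: "u = ae_class N f" "f \<in> borel_measurable N" "AE y in N. cmod (f y) \<le> C"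
    using assms(3) by (auto simp: Linf_def)
  have "f \<circ> \<phi> \<in> borel_measurable M"
    using assms(1) f(2) by (rule measurable_comp)
  moreover have "AE x in M. cmod ((f \<circ> \<phi>) x) \<le> C"
    using AE_pullback[OF assms(1,2) f(3)] by simp
  ultimately show ?thesis
    unfolding f(1) pullback_ae_class[OF assms(1,2) f(2)] Linf_def by blast
qed


section \<open>Bounded operators and Cuntz families\<close>

text \<open>Operators are HOL functions on classes; only their values on the \<open>L2\<close> carrier are
  meaningful, so all operator identities are stated on the carrier.\<close>

definition bounded_op ::
    "'b measure \<Rightarrow> 'a measure \<Rightarrow> (('b \<Rightarrow> complex) set \<Rightarrow> ('a \<Rightarrow> complex) set) \<Rightarrow> bool" where
  "bounded_op N M T \<longleftrightarrow>
     T \<in> L2 N \<rightarrow> L2 M \<and>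
     (\<forall>u\<in>L2 N. \<forall>v\<in>L2 N. T (l2_add N u v) = l2_add M (T u) (T v)) \<and>
     (\<forall>c. \<forall>u\<in>L2 N. T (l2_scale N c u) = l2_scale M c (T u)) \<and>
     (\<exists>C::real. \<forall>u\<in>L2 N. l2_norm M (T u) \<le> C * l2_norm N u)"

text \<open>The value of the adjoint of \<open>T\<close> at \<open>v\<close> is the element provided by the Riesz
  representation theorem.\<close>

definition adjoint_op ::
    "'b measure \<Rightarrow> 'a measure \<Rightarrow> (('b \<Rightarrow> complex) set \<Rightarrow> ('a \<Rightarrow> complex) set)
       \<Rightarrow> ('a \<Rightarrow> complex) set \<Rightarrow> ('b \<Rightarrow> complex) set" where
  "adjoint_op N M T v =
     (THE u. u \<in> L2 N \<and> (\<forall>w\<in>L2 N. l2_inner M (T w) v = l2_inner N w u))"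

definition cuntz_family ::
    "nat \<Rightarrow> 'b measure \<Rightarrow> 'a measure
       \<Rightarrow> (nat \<Rightarrow> ('b \<Rightarrow> complex) set \<Rightarrow> ('a \<Rightarrow> complex) set) \<Rightarrow> bool" where
  "cuntz_family n N M S \<longleftrightarrow>
     (\<forall>i\<in>{1..n}. bounded_op N M (S i)) \<and>
     (\<forall>i\<in>{1..n}. \<forall>j\<in>{1..n}. \<forall>u\<in>L2 N.
        adjoint_op N M (S i) (S j u) = (if i = j then u else l2_zero N)) \<and>
     (\<forall>v\<in>L2 M. l2_sum M {1..n} (\<lambda>i. S i (adjoint_op N M (S i) v)) = v)"

definition implements ::
    "nat \<Rightarrow> 'b measure \<Rightarrow> 'a measure
       \<Rightarrow> (nat \<Rightarrow> ('b \<Rightarrow> complex) set \<Rightarrow> ('a \<Rightarrow> complex) set)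
       \<Rightarrow> (('b \<Rightarrow> complex) set \<Rightarrow> ('a \<Rightarrow> complex) set) \<Rightarrow> bool" where
  "implements n N M S \<alpha> \<longleftrightarrow>
     (\<forall>f\<in>Linf N. \<forall>v\<in>L2 M.
        mult_op M (\<alpha> f) v
          = l2_sum M {1..n} (\<lambda>i. S i (mult_op N f (adjoint_op N M (S i) v))))"

end

theory Submission imports Defs begin

text \<open>Fix one section \<open>\<psi>\<close> and a measurable version \<open>A\<close> of its range. Between \<open>A\<close> and \<open>Y\<close> the maps
  \<open>\<phi>\<close> and \<open>\<psi>\<close> are mutually inverse and carry null sets to null sets, so that the measure
  \<open>B \<mapsto> \<mu> (\<phi>\<^sup>-\<^sup>1 B \<inter> A)\<close> on \<open>Y\<close> is equivalent to \<open>\<nu>\<close>. Its density \<open>w\<^sup>2\<close> with respect to \<open>\<nu>\<close> is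
  therefore finite and positive almost everywhere, and the Radon-Nikodym theorem turns into the
  change of variables \<open>\<integral>\<^sub>A G d\<mu> = \<integral> w\<^sup>2 (G \<circ> \<psi>) d\<nu>\<close> (\<open>integral_substitution\<close>).
  Hence \<open>S f = 1\<^sub>A (f / w) \<circ> \<phi>\<close> is an isometry of \<open>L2 \<nu>\<close> onto the functions in \<open>L2 \<mu>\<close>
  living on \<open>A\<close>, with adjoint \<open>S\<^sup>* g = w (g \<circ> \<psi>)\<close> (\<open>adjoint_branch_op\<close>), and \<open>S\<close>
  intertwines multiplication by \<open>f\<close> with multiplication by \<open>f \<circ> \<phi>\<close>. So \<open>S M\<^sub>f S\<^sup>*\<close> is
  multiplication by \<open>1\<^sub>A (f \<circ> \<phi>)\<close>. The ranges of the \<open>N\<close> sections partition \<open>X\<close> up to a null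
  set, so summing over the sections gives \<open>M\<^sub>\<alpha>\<^sub>(\<^sub>f\<^sub>)\<close>, the case \<open>f = 1\<close> being the completeness
  relation; disjointness of the ranges makes the operators mutually orthogonal
  (\<open>cuntz_family_of_branches\<close>).\<close>

section \<open>Square integrable functions and adjoints\<close>

lemma ae_class_in_L2:
  assumes "f \<in> borel_measurable M" "integrable M (\<lambda>x. (cmod (f x))\<^sup>2)"
  shows "ae_class M f \<in> L2 M"
  using assms by (auto simp: L2_def)

lemma L2_cases:
  assumes "u \<in> L2 M"
  obtains f where "u = ae_class M f" "f \<in> borel_measurable M" "integrable M (\<lambda>x. (cmod (f x))\<^sup>2)"
  using assms by (auto simp: L2_def)

lemma measurable_cnj [measurable]: "cnj \<in> borel_measurable borel"
  by (intro borel_measurable_continuous_onI continuous_intros)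

lemma integrable_mult_cnj:
  assumes [measurable]: "f \<in> borel_measurable M" "g \<in> borel_measurable M"
    and f: "integrable M (\<lambda>x. (cmod (f x))\<^sup>2)" and g: "integrable M (\<lambda>x. (cmod (g x))\<^sup>2)"
  shows "integrable M (\<lambda>x. f x * cnj (g x))"
proof (rule Bochner_Integration.integrable_bound[OF Bochner_Integration.integrable_add[OF f g]])
  show "AE x in M. norm (f x * cnj (g x)) \<le> norm ((cmod (f x))\<^sup>2 + (cmod (g x))\<^sup>2)"
  proof (intro AE_I2)
    fix x
    have "2 * (cmod (f x) * cmod (g x)) \<le> (cmod (f x))\<^sup>2 + (cmod (g x))\<^sup>2"
      using sum_squares_bound[of "cmod (f x)" "cmod (g x)"] by simp
    moreover have "0 \<le> cmod (f x) * cmod (g x)" by simp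
    ultimately have "cmod (f x) * cmod (g x) \<le> (cmod (f x))\<^sup>2 + (cmod (g x))\<^sup>2"
      by linarith
    then show "norm (f x * cnj (g x)) \<le> norm ((cmod (f x))\<^sup>2 + (cmod (g x))\<^sup>2)"
      by (simp add: norm_mult)
  qed
qed simp

lemma integrable_cmod_diff_square:
  assumes [measurable]: "f \<in> borel_measurable M" "g \<in> borel_measurable M"
    and f: "integrable M (\<lambda>x. (cmod (f x))\<^sup>2)" and g: "integrable M (\<lambda>x. (cmod (g x))\<^sup>2)"
  shows "integrable M (\<lambda>x. (cmod (f x - g x))\<^sup>2)"
proof (rule Bochner_Integration.integrable_bound)
  show "integrable M (\<lambda>x. 2 * (cmod (f x))\<^sup>2 + 2 * (cmod (g x))\<^sup>2)"
    using f g by simp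
  show "AE x in M. norm ((cmod (f x - g x))\<^sup>2) \<le> norm (2 * (cmod (f x))\<^sup>2 + 2 * (cmod (g x))\<^sup>2)"
  proof (intro AE_I2)
    fix x
    have "(cmod (f x - g x))\<^sup>2 \<le> (cmod (f x) + cmod (g x))\<^sup>2"
      by (intro power_mono norm_triangle_ineq4) simp
    also have "\<dots> \<le> 2 * (cmod (f x))\<^sup>2 + 2 * (cmod (g x))\<^sup>2"
      using sum_squares_bound[of "cmod (f x)" "cmod (g x)"] by (simp add: power2_sum)
    finally show "norm ((cmod (f x - g x))\<^sup>2) \<le> norm (2 * (cmod (f x))\<^sup>2 + 2 * (cmod (g x))\<^sup>2)"
      by simp
  qed
qed simp

text \<open>Testing the difference of the two vectors against itself shows that its norm vanishes.\<close>

lemma L2_eqI_inner: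
  assumes u: "u \<in> L2 M" and v: "v \<in> L2 M"
    and eq: "\<And>w. w \<in> L2 M \<Longrightarrow> l2_inner M w u = l2_inner M w v"
  shows "u = v"
proof -
  obtain f where f: "u = ae_class M f" and [measurable]: "f \<in> borel_measurable M"
    and fi: "integrable M (\<lambda>x. (cmod (f x))\<^sup>2)" using u by (rule L2_cases)
  obtain g where g: "v = ae_class M g" and [measurable]: "g \<in> borel_measurable M"
    and gi: "integrable M (\<lambda>x. (cmod (g x))\<^sup>2)" using v by (rule L2_cases)
  define d where "d = (\<lambda>x. f x - g x)"
  have [measurable]: "d \<in> borel_measurable M" by (simp add: d_def)
  have di: "integrable M (\<lambda>x. (cmod (d x))\<^sup>2)"
    unfolding d_def by (intro integrable_cmod_diff_square fi gi) simp_all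
  have "l2_inner M (ae_class M d) u = l2_inner M (ae_class M d) v"
    by (intro eq ae_class_in_L2 di) simp
  then have "(LINT x|M. d x * cnj (f x)) = (LINT x|M. d x * cnj (g x))"
    by (simp add: f g l2_inner_ae_class)
  then have "0 = (LINT x|M. d x * cnj (f x)) - (LINT x|M. d x * cnj (g x))"
    by simp
  also have "\<dots> = (LINT x|M. d x * cnj (f x) - d x * cnj (g x))"
    by (intro Bochner_Integration.integral_diff[symmetric] integrable_mult_cnj di fi gi) simp_all
  also have "\<dots> = (LINT x|M. complex_of_real ((cmod (d x))\<^sup>2))"
    by (intro Bochner_Integration.integral_cong refl)
      (simp add: d_def complex_norm_square algebra_simps del: of_real_power)
  finally have "(LINT x|M. (cmod (d x))\<^sup>2) = 0"
    by (simp del: of_real_power)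
  then have "AE x in M. (cmod (d x))\<^sup>2 = 0"
    using di by (subst (asm) integral_nonneg_eq_0_iff_AE) auto
  then show ?thesis
    unfolding f g by (intro ae_class_cong) (simp add: d_def)
qed

lemma adjoint_op_eqI:
  assumes "u \<in> L2 N" "\<And>w. w \<in> L2 N \<Longrightarrow> l2_inner M (T w) v = l2_inner N w u"
  shows "adjoint_op N M T v = u"
  unfolding adjoint_op_def
proof (rule the_equality)
  fix u' assume "u' \<in> L2 N \<and> (\<forall>w\<in>L2 N. l2_inner M (T w) v = l2_inner N w u')"
  then show "u' = u" using assms by (intro L2_eqI_inner) auto
qed (use assms in auto)

section \<open>The isometry attached to one section\<close>

text \<open>A measurable inverse of \<open>\<phi>\<close> modulo null sets, defined on \<open>N\<close> and with range \<open>A\<close>. Preservation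
  of null sets in the two directions is stated as transport of almost everywhere statements; in
  this form no image of a measurable set has to be measurable.\<close>

locale inverse_branch =
  fixes M :: "'a measure" and N :: "'b measure" and \<phi> :: "'a \<Rightarrow> 'b" and \<psi> :: "'b \<Rightarrow> 'a"
    and A :: "'a set"
  assumes finite_M: "finite_measure M" and sigma_finite_N: "sigma_finite_measure N"
    and measurable_phi [measurable]: "\<phi> \<in> M \<rightarrow>\<^sub>M N"
    and measurable_psi [measurable]: "\<psi> \<in> N \<rightarrow>\<^sub>M M"
    and sets_A [measurable]: "A \<in> sets M"
    and phi_psi: "\<And>y. y \<in> space N \<Longrightarrow> \<phi> (\<psi> y) = y"
    and psi_phi: "\<And>x. x \<in> A \<Longrightarrow> \<psi> (\<phi> x) = x"
    and AE_psi_in_A: "AE y in N. \<psi> y \<in> A"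
    and AE_phi: "\<And>P. AE y in N. P y \<Longrightarrow> AE x in M. P (\<phi> x)"
    and AE_psi: "\<And>P. AE x in M. P x \<Longrightarrow> AE y in N. P (\<psi> y)"
begin

definition image_measure :: "'b measure" where
  "image_measure = distr (density M (indicator A)) N \<phi>"

text \<open>The square root of the density of \<^term>\<open>image_measure\<close>, as a real-valued function.\<close>

definition weight :: "'b \<Rightarrow> real" where
  "weight y = sqrt (enn2real (RN_deriv N image_measure y))"

lemma sets_image_measure [measurable_cong]: "sets image_measure = sets N"
  by (simp add: image_measure_def)

lemma weight_measurable [measurable]: "weight \<in> borel_measurable N"
  unfolding weight_def by measurable

lemma emeasure_image_measure:
  assumes [measurable]: "B \<in> sets N"
  shows "emeasure image_measure B = emeasure M (A \<inter> (\<phi> -` B \<inter> space M))"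
proof -
  have "emeasure image_measure B = emeasure (density M (indicator A)) (\<phi> -` B \<inter> space M)"
    unfolding image_measure_def by (subst emeasure_distr) auto
  then show ?thesis
    by (simp add: emeasure_restricted)
qed

lemma density_image_measure: "density N (RN_deriv N image_measure) = image_measure"
proof -
  interpret sigma_finite_measure N by (rule sigma_finite_N)
  have "absolutely_continuous N image_measure"
    unfolding absolutely_continuous_def
  proof
    fix B assume B: "B \<in> null_sets N"
    then have [measurable]: "B \<in> sets N" by auto
    have "AE x in M. \<phi> x \<notin> B"
      by (intro AE_phi AE_not_in B)
    then have "AE x in M. x \<notin> A \<inter> (\<phi> -` B \<inter> space M)"
      by eventually_elim simp
    then have "A \<inter> (\<phi> -` B \<inter> space M) \<in> null_sets M"
      by (intro AE_iff_null_sets[THEN iffD2]) auto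
    then have "emeasure M (A \<inter> (\<phi> -` B \<inter> space M)) = 0"
      by auto
    then show "B \<in> null_sets image_measure"
      by (simp add: null_sets_def sets_image_measure emeasure_image_measure)
  qed
  then show ?thesis
    by (intro density_RN_deriv) (simp_all add: sets_image_measure)
qed

lemma AE_RN_deriv_finite: "AE y in N. RN_deriv N image_measure y \<noteq> \<infinity>"
proof -
  interpret N: sigma_finite_measure N by (rule sigma_finite_N)
  interpret M: finite_measure M by (rule finite_M)
  have "emeasure image_measure (space image_measure) \<noteq> \<infinity>"
    using emeasure_image_measure[of "space N"] M.emeasure_finite
    by (simp add: image_measure_def)
  then have "finite_measure image_measure"
    by (rule finite_measureI)
  then have "finite_measure (density N (RN_deriv N image_measure))"
    by (simp add: density_image_measure)
  then have "(\<integral>\<^sup>+y. RN_deriv N image_measure y \<partial>N) \<noteq> \<infinity>"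
    using finite_measure.emeasure_finite[of "density N (RN_deriv N image_measure)" "space N"]
    by (simp add: emeasure_density cong: nn_integral_cong)
  then show ?thesis
    by (intro nn_integral_PInf_AE) auto
qed

text \<open>If the density vanishes on \<open>Z\<close>, then almost no point of \<open>A\<close> is mapped into \<open>Z\<close> by \<open>\<phi>\<close>.
  Pulling this back along \<open>\<psi>\<close> says that almost no point of \<open>N\<close> lies in \<open>Z\<close>.\<close>

lemma AE_RN_deriv_pos: "AE y in N. RN_deriv N image_measure y \<noteq> 0"
proof -
  define Z where "Z = {y \<in> space N. RN_deriv N image_measure y = 0}"
  have [measurable]: "Z \<in> sets N" unfolding Z_def by measurable
  have "emeasure (density N (RN_deriv N image_measure)) Z
      = (\<integral>\<^sup>+y. RN_deriv N image_measure y * indicator Z y \<partial>N)"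
    by (simp add: emeasure_density)
  also have "\<dots> = (\<integral>\<^sup>+y. 0 \<partial>N)"
    by (intro nn_integral_cong) (auto simp: Z_def indicator_def)
  finally have "emeasure M (A \<inter> (\<phi> -` Z \<inter> space M)) = 0"
    by (simp add: density_image_measure emeasure_image_measure)
  then have "A \<inter> (\<phi> -` Z \<inter> space M) \<in> null_sets M"
    by (auto simp: null_sets_def)
  then have "AE y in N. \<psi> y \<notin> A \<inter> (\<phi> -` Z \<inter> space M)"
    by (intro AE_psi AE_not_in)
  then show ?thesis
    using AE_psi_in_A AE_space
  proof eventually_elim
    case (elim y)
    then show ?case
      using measurable_space[OF measurable_psi, of y] by (auto simp: phi_psi Z_def)
  qed
qed

lemma AE_weight: "AE y in N. weight y > 0 \<and> ennreal ((weight y)\<^sup>2) = RN_deriv N image_measure y"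
  using AE_RN_deriv_finite AE_RN_deriv_pos
proof eventually_elim
  case (elim y)
  then have "enn2real (RN_deriv N image_measure y) > 0"
    by (simp add: enn2real_positive_iff less_top[symmetric] zero_less_iff_neq_zero)
  with elim show ?case by (simp add: weight_def less_top)
qed

lemma image_measure_eq_density_weight: "image_measure = density N (\<lambda>y. ennreal ((weight y)\<^sup>2))"
proof -
  have "density N (\<lambda>y. ennreal ((weight y)\<^sup>2)) = density N (RN_deriv N image_measure)"
    using AE_weight by (intro density_cong) auto
  then show ?thesis by (simp add: density_image_measure)
qed

text \<open>On \<open>A\<close> the function \<open>G\<close> factors through \<open>\<phi>\<close> as \<open>(G \<circ> \<psi>) \<circ> \<phi>\<close>, and the integral of
  \<open>G \<circ> \<psi>\<close> against \<^term>\<open>image_measure\<close> can be computed either on \<open>M\<close> or on \<open>N\<close>.\<close>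

lemma
  fixes G :: "'a \<Rightarrow> 'c::{banach, second_countable_topology}"
  assumes [measurable]: "G \<in> borel_measurable M"
  shows integrable_substitution:
      "integrable M (\<lambda>x. indicator A x *\<^sub>R G x) \<longleftrightarrow> integrable N (\<lambda>y. (weight y)\<^sup>2 *\<^sub>R G (\<psi> y))"
    and integral_substitution:
      "(LINT x|M. indicator A x *\<^sub>R G x) = (LINT y|N. (weight y)\<^sup>2 *\<^sub>R G (\<psi> y))"
proof -
  have factor: "indicator A x *\<^sub>R G x = indicator A x *\<^sub>R G (\<psi> (\<phi> x))" for x
    by (cases "x \<in> A") (simp_all add: psi_phi)
  have dens: "density M (indicator A) = density M (\<lambda>x. ennreal (indicator A x))"
    by (intro density_cong) (auto simp: indicator_def)
  show "integrable M (\<lambda>x. indicator A x *\<^sub>R G x) \<longleftrightarrow> integrable N (\<lambda>y. (weight y)\<^sup>2 *\<^sub>R G (\<psi> y))"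
  proof -
    have "integrable M (\<lambda>x. indicator A x *\<^sub>R G x) \<longleftrightarrow> integrable image_measure (\<lambda>y. G (\<psi> y))"
      unfolding factor image_measure_def dens
      by (subst integrable_distr_eq) (auto simp: integrable_density)
    also have "\<dots> \<longleftrightarrow> integrable N (\<lambda>y. (weight y)\<^sup>2 *\<^sub>R G (\<psi> y))"
      unfolding image_measure_eq_density_weight by (subst integrable_density) auto
    finally show ?thesis .
  qed
  show "(LINT x|M. indicator A x *\<^sub>R G x) = (LINT y|N. (weight y)\<^sup>2 *\<^sub>R G (\<psi> y))"
  proof -
    have "(LINT x|M. indicator A x *\<^sub>R G x) = (LINT y|image_measure. G (\<psi> y))"
      unfolding factor image_measure_def dens
      by (subst integral_distr) (auto simp: integral_density)
    also have "\<dots> = (LINT y|N. (weight y)\<^sup>2 *\<^sub>R G (\<psi> y))"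
      unfolding image_measure_eq_density_weight by (subst integral_density) auto
    finally show ?thesis .
  qed
qed

text \<open>Dividing by the weight makes the composition with \<open>\<phi>\<close> isometric. The convention
  \<open>c / 0 = 0\<close> matters only where the weight vanishes, which is a null set.\<close>

definition branch_fun :: "('b \<Rightarrow> complex) \<Rightarrow> 'a \<Rightarrow> complex" where
  "branch_fun f x = indicator A x * (f (\<phi> x) / complex_of_real (weight (\<phi> x)))"

definition coisometry_fun :: "('a \<Rightarrow> complex) \<Rightarrow> 'b \<Rightarrow> complex" where
  "coisometry_fun g y = complex_of_real (weight y) * g (\<psi> y)"

definition branch_op :: "('b \<Rightarrow> complex) set \<Rightarrow> ('a \<Rightarrow> complex) set" where
  "branch_op u = ae_class M (branch_fun (rep u))"

lemma branch_fun_measurable [measurable]: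
  assumes [measurable]: "f \<in> borel_measurable N"
  shows "branch_fun f \<in> borel_measurable M"
  unfolding branch_fun_def[abs_def] by measurable

lemma coisometry_fun_measurable [measurable]:
  assumes [measurable]: "g \<in> borel_measurable M"
  shows "coisometry_fun g \<in> borel_measurable N"
  unfolding coisometry_fun_def[abs_def] by measurable

lemma branch_op_ae_class:
  assumes "f \<in> borel_measurable N"
  shows "branch_op (ae_class N f) = ae_class M (branch_fun f)"
  unfolding branch_op_def using AE_phi[OF rep_ae_class(2)[OF assms]]
  by (intro ae_class_cong) (auto simp: branch_fun_def)

lemma
  assumes [measurable]: "f \<in> borel_measurable N"
  shows integrable_branch_fun:
      "integrable M (\<lambda>x. (cmod (branch_fun f x))\<^sup>2) \<longleftrightarrow> integrable N (\<lambda>y. (cmod (f y))\<^sup>2)"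
    and integral_branch_fun:
      "(LINT x|M. (cmod (branch_fun f x))\<^sup>2) = (LINT y|N. (cmod (f y))\<^sup>2)"
proof -
  define G where "G x = (cmod (f (\<phi> x) / weight (\<phi> x)))\<^sup>2" for x
  have [measurable]: "G \<in> borel_measurable M" unfolding G_def by measurable
  have eq: "(cmod (branch_fun f x))\<^sup>2 = indicator A x *\<^sub>R G x" for x
    by (simp add: branch_fun_def G_def indicator_def)
  have AE: "AE y in N. (weight y)\<^sup>2 *\<^sub>R G (\<psi> y) = (cmod (f y))\<^sup>2"
    using AE_weight AE_space
    by eventually_elim (auto simp: G_def phi_psi norm_divide power_divide)
  show "integrable M (\<lambda>x. (cmod (branch_fun f x))\<^sup>2) \<longleftrightarrow> integrable N (\<lambda>y. (cmod (f y))\<^sup>2)"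
    unfolding eq integrable_substitution[OF \<open>G \<in> borel_measurable M\<close>]
    by (intro integrable_cong_AE AE) simp_all
  show "(LINT x|M. (cmod (branch_fun f x))\<^sup>2) = (LINT y|N. (cmod (f y))\<^sup>2)"
    unfolding eq integral_substitution[OF \<open>G \<in> borel_measurable M\<close>]
    by (intro integral_cong_AE AE) simp_all
qed

lemma bounded_op_branch_op: "bounded_op N M branch_op"
  unfolding bounded_op_def
proof (intro conjI ballI allI)
  show "branch_op \<in> L2 N \<rightarrow> L2 M"
    by (auto elim!: L2_cases simp: branch_op_ae_class integrable_branch_fun intro!: ae_class_in_L2)
next
  fix u v assume "u \<in> L2 N" "v \<in> L2 N"
  then obtain f g where uv: "u = ae_class N f" "v = ae_class N g"
    and [measurable]: "f \<in> borel_measurable N" "g \<in> borel_measurable N"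
    by (auto elim!: L2_cases)
  show "branch_op (l2_add N u v) = l2_add M (branch_op u) (branch_op v)"
    by (simp add: uv l2_add_ae_class branch_op_ae_class)
      (simp add: branch_fun_def[abs_def] algebra_simps add_divide_distrib)
next
  fix c u assume "u \<in> L2 N"
  then obtain f where u: "u = ae_class N f" and [measurable]: "f \<in> borel_measurable N"
    by (auto elim!: L2_cases)
  show "branch_op (l2_scale N c u) = l2_scale M c (branch_op u)"
    by (simp add: u l2_scale_ae_class branch_op_ae_class)
      (simp add: branch_fun_def[abs_def] algebra_simps)
next
  show "\<exists>C. \<forall>u\<in>L2 N. l2_norm M (branch_op u) \<le> C * l2_norm N u"
    by (intro exI[of _ 1])
      (auto elim!: L2_cases simp: branch_op_ae_class l2_norm_ae_class integral_branch_fun)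
qed

lemma integrable_coisometry_fun:
  assumes [measurable]: "g \<in> borel_measurable M" and g: "integrable M (\<lambda>x. (cmod (g x))\<^sup>2)"
  shows "integrable N (\<lambda>y. (cmod (coisometry_fun g y))\<^sup>2)"
proof -
  have "integrable M (\<lambda>x. indicator A x *\<^sub>R (cmod (g x))\<^sup>2)"
    using g by (intro integrable_mult_indicator) auto
  then show ?thesis
    by (subst (asm) integrable_substitution)
      (auto simp: coisometry_fun_def norm_mult power_mult_distrib)
qed

lemma adjoint_branch_op:
  assumes [measurable]: "g \<in> borel_measurable M" and g: "integrable M (\<lambda>x. (cmod (g x))\<^sup>2)"
  shows "adjoint_op N M branch_op (ae_class M g) = ae_class N (coisometry_fun g)"
proof (rule adjoint_op_eqI)
  show "ae_class N (coisometry_fun g) \<in> L2 N"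
    using assms by (intro ae_class_in_L2 integrable_coisometry_fun) auto
  fix w assume "w \<in> L2 N"
  then obtain f where w: "w = ae_class N f" and [measurable]: "f \<in> borel_measurable N"
    by (auto elim!: L2_cases)
  have "l2_inner M (branch_op w) (ae_class M g) = (LINT x|M. branch_fun f x * cnj (g x))"
    by (simp add: w branch_op_ae_class l2_inner_ae_class)
  also have "\<dots> = (LINT x|M. indicator A x *\<^sub>R (f (\<phi> x) / weight (\<phi> x) * cnj (g x)))"
    by (intro Bochner_Integration.integral_cong) (auto simp: branch_fun_def indicator_def)
  also have "\<dots> = (LINT y|N. (weight y)\<^sup>2 *\<^sub>R (f (\<phi> (\<psi> y)) / weight (\<phi> (\<psi> y)) * cnj (g (\<psi> y))))"
    by (rule integral_substitution) measurable
  also have "\<dots> = (LINT y|N. f y * cnj (coisometry_fun g y))"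
  proof (intro integral_cong_AE)
    show "AE y in N. (weight y)\<^sup>2 *\<^sub>R (f (\<phi> (\<psi> y)) / weight (\<phi> (\<psi> y)) * cnj (g (\<psi> y)))
        = f y * cnj (coisometry_fun g y)"
      using AE_weight AE_space
      by eventually_elim
        (auto simp: coisometry_fun_def phi_psi scaleR_conv_of_real field_simps power2_eq_square)
  qed measurable
  also have "\<dots> = l2_inner N w (ae_class N (coisometry_fun g))"
    by (simp add: w l2_inner_ae_class)
  finally show "l2_inner M (branch_op w) (ae_class M g)
      = l2_inner N w (ae_class N (coisometry_fun g))" .
qed

text \<open>The operator \<open>S M\<^sub>f S\<^sup>*\<close> is multiplication by \<open>1\<^sub>A (f \<circ> \<phi>)\<close>: the weights cancel, and
  \<open>\<psi> \<circ> \<phi>\<close> is the identity on \<open>A\<close>.\<close>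

lemma AE_branch_mult_coisometry:
  "AE x in M. branch_fun (\<lambda>y. f y * coisometry_fun g y) x = indicator A x * (f (\<phi> x) * g x)"
proof -
  have "AE x in M. weight (\<phi> x) > 0"
    using AE_weight by (intro AE_phi) auto
  then show ?thesis
    by eventually_elim (auto simp: branch_fun_def coisometry_fun_def indicator_def psi_phi)
qed

end

section \<open>Cuntz families from disjoint sections\<close>

lemma cuntz_family_of_branches:
  assumes branch: "\<And>i. i \<in> {1..n} \<Longrightarrow> inverse_branch M N \<phi> (\<psi> i) (A i)"
    and disjoint: "\<And>i j. i \<in> {1..n} \<Longrightarrow> j \<in> {1..n} \<Longrightarrow> i \<noteq> j \<Longrightarrow> A i \<inter> A j = {}"
    and cover: "AE x in M. x \<in> (\<Union>i\<in>{1..n}. A i)"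
    and phi [measurable]: "\<phi> \<in> M \<rightarrow>\<^sub>M N" and null: "inverse_preserves_null_sets M N \<phi>"
  defines "S \<equiv> \<lambda>i. inverse_branch.branch_op M N \<phi> (A i)"
  shows "cuntz_family n N M S" "implements n N M S (pullback M \<phi>)"
proof -
  \<comment> \<open>On the union of the disjoint sets \<open>A i\<close> exactly one indicator function equals 1.\<close>
  have sum_indicator: "(\<Sum>i\<in>{1..n}. indicator (A i) x * c) = c"
    if "x \<in> (\<Union>i\<in>{1..n}. A i)" for x and c :: complex
  proof -
    obtain k where k: "k \<in> {1..n}" "x \<in> A k" using \<open>x \<in> (\<Union>i\<in>{1..n}. A i)\<close> by auto
    have "(\<Sum>i\<in>{1..n}. indicator (A i) x * c) = (\<Sum>i\<in>{1..n}. if i = k then c else 0)"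
      using k disjoint by (intro sum.cong refl) (auto simp: indicator_def)
    then show ?thesis using k by simp
  qed
  have sum_branches: "l2_sum M {1..n} (\<lambda>i. S i (ae_class N
        (\<lambda>y. f y * inverse_branch.coisometry_fun M N \<phi> (\<psi> i) (A i) g y)))
      = ae_class M (\<lambda>x. f (\<phi> x) * g x)"
    if [measurable]: "f \<in> borel_measurable N" "g \<in> borel_measurable M" for f g
  proof -
    have op: "S i (ae_class N (\<lambda>y. f y * inverse_branch.coisometry_fun M N \<phi> (\<psi> i) (A i) g y))
        = ae_class M (\<lambda>x. indicator (A i) x * (f (\<phi> x) * g x))" if "i \<in> {1..n}" for i
    proof -
      interpret inverse_branch M N \<phi> "\<psi> i" "A i" by (rule branch) fact
      show ?thesis
        unfolding S_def
        by (subst branch_op_ae_class) (auto intro!: ae_class_cong AE_branch_mult_coisometry)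
    qed
    have "l2_sum M {1..n} (\<lambda>i. S i (ae_class N
          (\<lambda>y. f y * inverse_branch.coisometry_fun M N \<phi> (\<psi> i) (A i) g y)))
        = l2_sum M {1..n} (\<lambda>i. ae_class M (\<lambda>x. indicator (A i) x * (f (\<phi> x) * g x)))"
      unfolding l2_sum_def using op by simp
    also have "\<dots> = ae_class M (\<lambda>x. \<Sum>i\<in>{1..n}. indicator (A i) x * (f (\<phi> x) * g x))"
    proof (rule l2_sum_ae_class)
      fix i assume "i \<in> {1..n}"
      then interpret inverse_branch M N \<phi> "\<psi> i" "A i" by (rule branch)
      show "(\<lambda>x. indicator (A i) x * (f (\<phi> x) * g x)) \<in> borel_measurable M" by measurable
    qed simp
    also have "\<dots> = ae_class M (\<lambda>x. f (\<phi> x) * g x)"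
      by (intro ae_class_cong eventually_mono[OF cover] sum_indicator)
    finally show ?thesis .
  qed
  have adjoint: "adjoint_op N M (S i) (ae_class M g)
      = ae_class N (inverse_branch.coisometry_fun M N \<phi> (\<psi> i) (A i) g)"
    if "i \<in> {1..n}" "g \<in> borel_measurable M" "integrable M (\<lambda>x. (cmod (g x))\<^sup>2)" for i g
    unfolding S_def using that by (intro inverse_branch.adjoint_branch_op branch)
  have coisometry_measurable:
    "inverse_branch.coisometry_fun M N \<phi> (\<psi> i) (A i) g \<in> borel_measurable N"
    if "i \<in> {1..n}" "g \<in> borel_measurable M" for i g
    using that by (intro inverse_branch.coisometry_fun_measurable branch)
  show "implements n N M S (pullback M \<phi>)"
    unfolding implements_def
  proof (intro ballI)
    fix F v assume "F \<in> Linf N" "v \<in> L2 M"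
    then obtain f g where F: "F = ae_class N f" and v: "v = ae_class M g"
      and [measurable]: "f \<in> borel_measurable N" "g \<in> borel_measurable M"
      and g: "integrable M (\<lambda>x. (cmod (g x))\<^sup>2)"
      by (auto elim!: L2_cases simp: Linf_def)
    have "mult_op M (pullback M \<phi> F) v = ae_class M (\<lambda>x. f (\<phi> x) * g x)"
      unfolding F v by (subst pullback_ae_class[OF phi null]) (auto simp: mult_op_ae_class o_def)
    also have "\<dots> = l2_sum M {1..n} (\<lambda>i. S i (ae_class N
        (\<lambda>y. f y * inverse_branch.coisometry_fun M N \<phi> (\<psi> i) (A i) g y)))"
      by (rule sum_branches[of f g, symmetric]) simp_all
    also have "\<dots> = l2_sum M {1..n} (\<lambda>i. S i (mult_op N F (adjoint_op N M (S i) v)))"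
      unfolding l2_sum_def F v
      by (simp add: adjoint g mult_op_ae_class coisometry_measurable)
    finally show "mult_op M (pullback M \<phi> F) v
        = l2_sum M {1..n} (\<lambda>i. S i (mult_op N F (adjoint_op N M (S i) v)))" .
  qed
  show "cuntz_family n N M S"
    unfolding cuntz_family_def
  proof (intro conjI ballI)
    show "bounded_op N M (S i)" if "i \<in> {1..n}" for i
      unfolding S_def by (rule inverse_branch.bounded_op_branch_op[OF branch[OF that]])
  next
    fix i j u assume i: "i \<in> {1..n}" and j: "j \<in> {1..n}" and "u \<in> L2 N"
    then obtain f where u: "u = ae_class N f" and [measurable]: "f \<in> borel_measurable N"
      and f: "integrable N (\<lambda>x. (cmod (f x))\<^sup>2)"
      by (auto elim!: L2_cases)
    interpret I: inverse_branch M N \<phi> "\<psi> i" "A i" by (rule branch[OF i])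
    interpret J: inverse_branch M N \<phi> "\<psi> j" "A j" by (rule branch[OF j])
    have "adjoint_op N M (S i) (S j u) = ae_class N (I.coisometry_fun (J.branch_fun f))"
      using f unfolding u
      by (simp add: S_def J.branch_op_ae_class I.adjoint_branch_op J.integrable_branch_fun)
    also have "\<dots> = ae_class N (if i = j then f else (\<lambda>_. 0))"
    proof (intro ae_class_cong)
      show "AE y in N. I.coisometry_fun (J.branch_fun f) y = (if i = j then f else (\<lambda>_. 0)) y"
        using I.AE_weight I.AE_psi_in_A AE_space
      proof eventually_elim
        case (elim y)
        show ?case
        proof (cases "i = j")
          case True
          then show ?thesis
            using elim by (simp add: J.coisometry_fun_def J.branch_fun_def J.phi_psi)
        next
          case False
          then have "\<psi> i y \<notin> A j" using disjoint[OF i j] elim by auto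
          then show ?thesis
            using False by (simp add: I.coisometry_fun_def J.branch_fun_def)
        qed
      qed
    qed
    finally show "adjoint_op N M (S i) (S j u) = (if i = j then u else l2_zero N)"
      by (simp add: u l2_zero_def)
  next
    fix v assume "v \<in> L2 M"
    then obtain g where v: "v = ae_class M g" and [measurable]: "g \<in> borel_measurable M"
      and g: "integrable M (\<lambda>x. (cmod (g x))\<^sup>2)"
      by (auto elim!: L2_cases)
    have "l2_sum M {1..n} (\<lambda>i. S i (adjoint_op N M (S i) v)) = l2_sum M {1..n} (\<lambda>i. S i (ae_class N
        (\<lambda>y. 1 * inverse_branch.coisometry_fun M N \<phi> (\<psi> i) (A i) g y)))"
      unfolding l2_sum_def v by (simp add: adjoint g)
    also have "\<dots> = ae_class M (\<lambda>x. 1 * g x)"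
      by (rule sum_branches[where f = "\<lambda>_. 1"]) simp_all
    finally show "l2_sum M {1..n} (\<lambda>i. S i (adjoint_op N M (S i) v)) = v"
      by (simp add: v)
  qed
qed

text \<open>The preimage of a null set \<open>F\<close> under a section \<open>\<psi>\<close> of \<open>\<phi>\<close> lies in \<open>\<phi> ` F\<close>.\<close>

lemma AE_section:
  assumes "preserves_null_sets M N \<phi>" "\<psi> \<in> N \<rightarrow>\<^sub>M M"
    and "\<And>y. y \<in> space N \<Longrightarrow> \<phi> (\<psi> y) = y" and "AE x in M. P x"
  shows "AE y in N. P (\<psi> y)"
proof -
  obtain F where F: "{x \<in> space M. \<not> P x} \<subseteq> F" "F \<in> null_sets M"
    using assms(4) unfolding eventually_ae_filter by blast
  then have "\<phi> ` F \<in> null_sets (completion N)"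
    using assms(1) by (auto simp: preserves_null_sets_def intro: null_sets_completionI)
  moreover have "{y \<in> space N. \<not> P (\<psi> y)} \<subseteq> \<phi> ` F"
  proof
    fix y assume y: "y \<in> {y \<in> space N. \<not> P (\<psi> y)}"
    then have "\<psi> y \<in> F" using F(1) measurable_space[OF assms(2)] by auto
    then show "y \<in> \<phi> ` F" using assms(3)[of y] y by (metis (mono_tags) imageI mem_Collect_eq)
  qed
  ultimately have "AE y in completion N. P (\<psi> y)"
    by (intro AE_I'[of "\<phi> ` F"]) auto
  then show ?thesis by (simp add: AE_completion_iff)
qed

lemma AE_in_main_part:
  assumes "A \<in> sets (completion M)"
  shows "AE x in M. x \<in> main_part M A \<longleftrightarrow> x \<in> A"
proof -
  obtain F where F: "F \<in> null_sets M" "null_part M A \<subseteq> F"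
    using null_part[OF assms] by auto
  then have "AE x in M. x \<notin> F" by (intro AE_not_in)
  then show ?thesis
    by eventually_elim (use F main_part_null_part_Un[OF assms] in blast)
qed

theorem proposition2p2:
  fixes \<mu> :: "'a::t2_space measure" and \<nu> :: "'b::t2_space measure"
    and \<phi> :: "'a \<Rightarrow> 'b" and \<psi> :: "nat \<Rightarrow> 'b \<Rightarrow> 'a" and N :: nat
  assumes "compact (UNIV :: 'a set)" and "compact (UNIV :: 'b set)"
    and "prob_space \<mu>" and "regular_borel_measure \<mu>"
    and "prob_space \<nu>" and "regular_borel_measure \<nu>"
    and "\<phi> \<in> borel \<rightarrow>\<^sub>M borel" and "surj \<phi>"
    and "preserves_null_sets \<mu> \<nu> \<phi>" and "inverse_preserves_null_sets \<mu> \<nu> \<phi>"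
    and "\<And>i. i \<in> {1..N} \<Longrightarrow> borel_section \<phi> (\<psi> i)"
    and "\<And>i. i \<in> {1..N} \<Longrightarrow> range (\<psi> i) \<in> sets (completion \<mu>)"
    and "\<And>i j. i \<in> {1..N} \<Longrightarrow> j \<in> {1..N} \<Longrightarrow> i \<noteq> j \<Longrightarrow> range (\<psi> i) \<inter> range (\<psi> j) = {}"
    and "UNIV - (\<Union>i\<in>{1..N}. range (\<psi> i)) \<in> null_sets (completion \<mu>)"
  shows "\<exists>S. cuntz_family N \<nu> \<mu> S \<and> implements N \<nu> \<mu> S (pullback \<mu> \<phi>)"
proof -
  have sets: "sets \<mu> = sets borel" "sets \<nu> = sets borel"
    using assms(4,6) by (auto simp: regular_borel_measure_def)
  have phi: "\<phi> \<in> \<mu> \<rightarrow>\<^sub>M \<nu>"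
    using assms(7) by (simp cong: measurable_cong_sets add: sets)
  have psi: "\<psi> i \<in> \<nu> \<rightarrow>\<^sub>M \<mu>" and inv: "\<phi> (\<psi> i y) = y" if "i \<in> {1..N}" for i y
    using assms(11)[OF that] by (auto simp: borel_section_def sets fun_eq_iff
      cong: measurable_cong_sets)
  \<comment> \<open>The ranges are only measurable for the completion, so their Borel parts replace them.\<close>
  define A where "A i = main_part \<mu> (range (\<psi> i))" for i
  have sets_A: "A i \<in> sets \<mu>" if "i \<in> {1..N}" for i
    unfolding A_def using assms(12)[OF that] by simp
  have A_range: "A i \<subseteq> range (\<psi> i)" if "i \<in> {1..N}" for i
    unfolding A_def using main_part_null_part_Un[OF assms(12)[OF that]] by blast
  have AE_A: "AE x in \<mu>. x \<in> A i \<longleftrightarrow> x \<in> range (\<psi> i)" if "i \<in> {1..N}" for i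
    unfolding A_def using assms(12)[OF that] by (rule AE_in_main_part)
  have AE_psi: "AE y in \<nu>. P (\<psi> i y)" if "i \<in> {1..N}" "AE x in \<mu>. P x" for i P
    using that by (intro AE_section[OF assms(9)] psi inv) auto
  have branch: "inverse_branch \<mu> \<nu> \<phi> (\<psi> i) (A i)" if i: "i \<in> {1..N}" for i
  proof (intro inverse_branch.intro)
    show "finite_measure \<mu>" "sigma_finite_measure \<nu>"
      using assms(3,5) by (simp_all add: prob_space.finite_measure prob_space_imp_sigma_finite)
    show "\<phi> \<in> \<mu> \<rightarrow>\<^sub>M \<nu>" "\<psi> i \<in> \<nu> \<rightarrow>\<^sub>M \<mu>" "A i \<in> sets \<mu>"
      by (fact phi psi[OF i] sets_A[OF i])+
    show "\<phi> (\<psi> i y) = y" for y by (rule inv[OF i])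
    show "\<psi> i (\<phi> x) = x" if "x \<in> A i" for x
    proof -
      from that obtain y where "x = \<psi> i y" using A_range[OF i] by blast
      then show ?thesis by (simp only: inv[OF i])
    qed
    show "AE y in \<nu>. \<psi> i y \<in> A i"
      using AE_psi[OF i AE_A[OF i]] by simp
    show "AE x in \<mu>. P (\<phi> x)" if "AE y in \<nu>. P y" for P
      using that by (rule AE_pullback[OF phi assms(10)])
    show "AE y in \<nu>. P (\<psi> i y)" if "AE x in \<mu>. P x" for P
      using that by (rule AE_psi[OF i])
  qed
  have disjoint: "A i \<inter> A j = {}" if "i \<in> {1..N}" "j \<in> {1..N}" "i \<noteq> j" for i j
    using A_range that assms(13)[OF that] by blast
  have "AE x in completion \<mu>. x \<in> (\<Union>i\<in>{1..N}. range (\<psi> i))"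
    by (intro AE_I'[OF assms(14)]) auto
  then have "AE x in \<mu>. x \<in> (\<Union>i\<in>{1..N}. range (\<psi> i))"
    by (simp add: AE_completion_iff)
  moreover have "AE x in \<mu>. \<forall>i\<in>{1..N}. x \<in> A i \<longleftrightarrow> x \<in> range (\<psi> i)"
    by (intro AE_finite_allI AE_A) auto
  ultimately have cover: "AE x in \<mu>. x \<in> (\<Union>i\<in>{1..N}. A i)"
    by eventually_elim blast
  show ?thesis
    using cuntz_family_of_branches[OF branch disjoint cover phi assms(10)] by blast
qed

end
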